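(* Let $T_1$ and $T_2$ be switching equivalent tournaments on the same vertex set $V$. Then $T_1$ is a CR tournament if and only if $T_2$ is a CR tournament.
   Context: A tournament is a digraph with exactly one arc between each pair of distinct vertices. For distinct vertices write $\theta_T(u,v)=1$ if $u\to v$, $-1$ otherwise. Skew-adjacency matrix $S_T$: entry $1$ if $v_i\to v_j$, $-1$ if $v_j\to v_i$, $0$ on the diagonal; $\det(T)=\det(S_T)$. For odd $k\ge1$, $\mathcal{D}_k$ is the set of tournaments all of whose induced subtournaments have determinant at most $k^2$; $\mathcal{D}_{-1}=\emptyset$. The switch of $T$ w.r.t. $W\subseteq V(T)$ reverses all arcs between $W$ and $V(T)\setminus W$; $T$ and its switches are switching equivalent. A diamond is a 4-tournament consisting of a 3-cycle plus a vertex dominating all of it or dominated by all of it. Two vertices $u_1,u_2$ of $T$ are covertices and revertices if $|V(T)|=2$; if $|V(T)|\ge3$ they are covertices if $\theta_T(u_1,v)=\theta_T(u_2,v)$ for all other $v$, revertices if $\theta_T(u_1,v)=-\theta_T(u_2,v)$ for all other $v$; CR-associated if covertices or revertices. For $u\notin V(T)=\{w_1,\dots,w_n\}$ and $\sigma=(r_1,\dots,r_n)\in\{\pm1\}^n$, $T(u,\sigma)$ extends $T$ by $u$ with $u\to w_i$ iff $r_i=1$; $u$ is a CR vertex for $T$ with $\sigma$ if $u$ is CR-associated in $T(u,\sigma)$ with some vertex of $T$, otherwise a non-CR vertex. Let $T\in\mathcal{D}_k\setminus\mathcal{D}_{k-2}$ for some odd $k$. $T$ is a CR tournament if $T$ is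 a 1-tournament, a 2-tournament or a diamond, or else for every $u\notin V(T)$ and every $\sigma$ with $u$ a non-CR vertex for $T$ with $\sigma$, $T(u,\sigma)\notin\mathcal{D}_k$. *)

theory Defs
  imports "Graph_Theory.Graph_Theory" "Jordan_Normal_Form.Determinant"
    "HOL-Library.Infinite_Typeclass" "HOL-Library.FuncSet"
begin

locale tournament = pair_digraph T for T :: "'a pair_pre_digraph" +
  assumes exactly_one_arc:
    "\<lbrakk>u \<in> pverts T; v \<in> pverts T; u \<noteq> v\<rbrakk> \<Longrightarrow> (u, v) \<in> parcs T \<longleftrightarrow> (v, u) \<notin> parcs T"

definition theta :: "'a pair_pre_digraph \<Rightarrow> 'a \<Rightarrow> 'a \<Rightarrow> int" where
  "theta T u v = (if (u, v) \<in> parcs T then 1 else -1)"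

definition skew_adjacency :: "'a pair_pre_digraph \<Rightarrow> 'a list \<Rightarrow> int mat" where
  "skew_adjacency T vs = mat (length vs) (length vs) (\<lambda>(i, j).
     if (vs ! i, vs ! j) \<in> parcs T then 1
     else if (vs ! j, vs ! i) \<in> parcs T then -1
     else 0)"

text \<open>The value does not depend on the chosen enumeration of the vertices; see
  \<open>tournament_det_eq\<close> below.\<close>

definition tournament_det :: "'a pair_pre_digraph \<Rightarrow> int" where
  "tournament_det T =
     det (skew_adjacency T (SOME vs. distinct vs \<and> set vs = pverts T))"

lemma tournament_det_eq:
  assumes "distinct vs" "set vs = pverts T"
  shows "tournament_det T = det (skew_adjacency T vs)"
proof -
  define ws where "ws = (SOME vs. distinct vs \<and> set vs = pverts T)"
  have ws: "distinct ws \<and> set ws = pverts T"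
    unfolding ws_def by (rule someI[of _ vs]) (use assms in simp)
  define n where "n = length vs"
  have "mset ws = mset vs"
    using assms ws by (metis set_eq_iff_mset_eq_distinct)
  then obtain p where p: "p permutes {..<length vs}" "permute_list p vs = ws"
    using mset_eq_permutation by blast
  have p': "p permutes {0..<n}"
    using p(1) by (simp add: n_def atLeast0LessThan)
  have len: "length ws = n"
    using p(2) by (auto simp: n_def)
  have nth: "ws ! i = vs ! p i" if "i < n" for i
    using that p by (auto simp: n_def permute_list_nth)
  have pn: "p i < n" if "i < n" for i
    using that permutes_in_image[OF p', of i] by simp
  define A where "A = skew_adjacency T vs"
  define B where "B = mat n n (\<lambda>(i, j). A $$ (p i, j))"
  have A: "A \<in> carrier_mat n n"
    by (simp add: A_def skew_adjacency_def n_def)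
  have B: "B \<in> carrier_mat n n"
    by (simp add: B_def)
  have "det (skew_adjacency T ws) = det (transpose_mat (skew_adjacency T ws))"
    by (rule det_transpose[symmetric, of _ n]) (simp add: skew_adjacency_def len)
  also have "transpose_mat (skew_adjacency T ws) =
      mat n n (\<lambda>(i, j). transpose_mat B $$ (p i, j))"
    by (rule eq_matI) (auto simp: skew_adjacency_def B_def A_def len nth pn n_def[symmetric])
  also have "det \<dots> = signof p * det (transpose_mat B)"
    by (rule det_permute_rows) (use B p' in auto)
  also have "det (transpose_mat B) = det B"
    by (rule det_transpose[OF B])
  also have "det B = signof p * det A"
    unfolding B_def by (rule det_permute_rows[OF A p'])
  also have "signof p * (signof p * det A) = det A"
    by (simp add: sign_def)
  finally show ?thesis
    unfolding tournament_det_def ws_def[symmetric] A_def .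
qed

text \<open>\<open>\<D> k\<close> is meant for odd \<open>k \<ge> 1\<close> and for \<open>k = -1\<close>.\<close>

definition det_class :: "int \<Rightarrow> 'a pair_pre_digraph set" (\<open>\<D>\<close>) where
  "\<D> k = (if k = -1 then {}
           else {T. tournament T \<and>
                  (\<forall>H. induced_subgraph (with_proj H) (with_proj T) \<longrightarrow>
                       tournament_det H \<le> k\<^sup>2)})"

definition switch :: "'a pair_pre_digraph \<Rightarrow> 'a set \<Rightarrow> 'a pair_pre_digraph" where
  "switch T W = \<lparr>pverts = pverts T,
     parcs = {(u, v). (u, v) \<in> parcs T \<and> (u \<in> W \<longleftrightarrow> v \<in> W)}
           \<union> {(u, v). (v, u) \<in> parcs T \<and> (u \<in> W \<longleftrightarrow> v \<notin> W)}\<rparr>"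

definition switching_equivalent :: "'a pair_pre_digraph \<Rightarrow> 'a pair_pre_digraph \<Rightarrow> bool" where
  "switching_equivalent T\<^sub>1 T\<^sub>2 \<longleftrightarrow> (\<exists>W \<subseteq> pverts T\<^sub>1. T\<^sub>2 = switch T\<^sub>1 W)"

definition diamond :: "'a pair_pre_digraph \<Rightarrow> bool" where
  "diamond T \<longleftrightarrow> tournament T \<and>
     (\<exists>a b c d. distinct [a, b, c, d] \<and> pverts T = {a, b, c, d} \<and>
        {(a, b), (b, c), (c, a)} \<subseteq> parcs T \<and>
        ({(d, a), (d, b), (d, c)} \<subseteq> parcs T \<or> {(a, d), (b, d), (c, d)} \<subseteq> parcs T))"

definition covertices :: "'a pair_pre_digraph \<Rightarrow> 'a \<Rightarrow> 'a \<Rightarrow> bool" where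
  "covertices T u\<^sub>1 u\<^sub>2 \<longleftrightarrow> u\<^sub>1 \<in> pverts T \<and> u\<^sub>2 \<in> pverts T \<and> u\<^sub>1 \<noteq> u\<^sub>2 \<and>
     (card (pverts T) = 2 \<or>
      card (pverts T) \<ge> 3 \<and> (\<forall>v \<in> pverts T - {u\<^sub>1, u\<^sub>2}. theta T u\<^sub>1 v = theta T u\<^sub>2 v))"

definition revertices :: "'a pair_pre_digraph \<Rightarrow> 'a \<Rightarrow> 'a \<Rightarrow> bool" where
  "revertices T u\<^sub>1 u\<^sub>2 \<longleftrightarrow> u\<^sub>1 \<in> pverts T \<and> u\<^sub>2 \<in> pverts T \<and> u\<^sub>1 \<noteq> u\<^sub>2 \<and>
     (card (pverts T) = 2 \<or>
      card (pverts T) \<ge> 3 \<and> (\<forall>v \<in> pverts T - {u\<^sub>1, u\<^sub>2}. theta T u\<^sub>1 v = - theta T u\<^sub>2 v))"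

definition CR_associated :: "'a pair_pre_digraph \<Rightarrow> 'a \<Rightarrow> 'a \<Rightarrow> bool" where
  "CR_associated T u\<^sub>1 u\<^sub>2 \<longleftrightarrow> covertices T u\<^sub>1 u\<^sub>2 \<or> revertices T u\<^sub>1 u\<^sub>2"

text \<open>The sign vector is indexed by the vertices themselves: the sign \<open>r\<^sub>i\<close>
  belonging to the vertex \<open>w\<^sub>i\<close> is \<open>\<sigma> w\<^sub>i\<close>.\<close>

definition vertex_extension :: "'a pair_pre_digraph \<Rightarrow> 'a \<Rightarrow> ('a \<Rightarrow> int) \<Rightarrow> 'a pair_pre_digraph" where
  "vertex_extension T u \<sigma> = \<lparr>pverts = insert u (pverts T),
     parcs = parcs T \<union> {(u, w) | w. w \<in> pverts T \<and> \<sigma> w = 1}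
                     \<union> {(w, u) | w. w \<in> pverts T \<and> \<sigma> w \<noteq> 1}\<rparr>"

definition CR_vertex :: "'a pair_pre_digraph \<Rightarrow> 'a \<Rightarrow> ('a \<Rightarrow> int) \<Rightarrow> bool" where
  "CR_vertex T u \<sigma> \<longleftrightarrow> (\<exists>w \<in> pverts T. CR_associated (vertex_extension T u \<sigma>) u w)"

text \<open>The vertex type is infinite so that vertices \<open>u\<close> outside the finite set
  \<open>pverts T\<close> always exist. The number \<open>k\<close> exists and is unique for every
  tournament; see \<open>ex1_det_class\<close> below.\<close>

definition CR_tournament :: "('a::infinite) pair_pre_digraph \<Rightarrow> bool" where
  "CR_tournament T \<longleftrightarrow> (\<exists>k \<ge> 1. odd k \<and> T \<in> \<D> k - \<D> (k - 2) \<and>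
     (card (pverts T) = 1 \<or> card (pverts T) = 2 \<or> diamond T \<or>
      (\<forall>u \<sigma>. u \<notin> pverts T \<longrightarrow> \<sigma> \<in> pverts T \<rightarrow> {-1, 1} \<longrightarrow> \<not> CR_vertex T u \<sigma> \<longrightarrow>
         vertex_extension T u \<sigma> \<notin> \<D> k)))"

lemma det_class_mono:
  assumes "1 \<le> j" "j \<le> k"
  shows "\<D> j \<subseteq> \<D> k"
proof -
  have "j\<^sup>2 \<le> k\<^sup>2"
    using assms by (intro power_mono) auto
  then show ?thesis
    using assms by (auto simp: det_class_def intro: order_trans)
qed

lemma ex1_det_class:
  assumes "tournament T"
  shows "\<exists>!k. k \<ge> 1 \<and> odd k \<and> T \<in> \<D> k - \<D> (k - 2)"
proof -
  interpret tournament T by fact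
  let ?S = "{H. induced_subgraph (with_proj H) (with_proj T)}"
  have "?S \<subseteq> (\<lambda>(V, E). \<lparr>pverts = V, parcs = E\<rparr>) ` (Pow (pverts T) \<times> Pow (parcs T))"
  proof
    fix H assume "H \<in> ?S"
    then have "pverts H \<subseteq> pverts T" "parcs H \<subseteq> parcs T"
      by (auto simp: induced_subgraph_def subgraph_def)
    then have "(pverts H, parcs H) \<in> Pow (pverts T) \<times> Pow (parcs T)"
      by simp
    moreover have "H = (\<lambda>(V, E). \<lparr>pverts = V, parcs = E\<rparr>) (pverts H, parcs H)"
      by simp
    ultimately show "H \<in> (\<lambda>(V, E). \<lparr>pverts = V, parcs = E\<rparr>) ` (Pow (pverts T) \<times> Pow (parcs T))"
      by blast
  qed
  then have fin: "finite ?S"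
    by (rule finite_subset) (simp add: pair_finite_verts pair_finite_arcs)
  define M where "M = (\<Sum>H\<in>?S. \<bar>tournament_det H\<bar>)"
  have M0: "M \<ge> 0" by (simp add: M_def sum_nonneg)
  have big: "T \<in> \<D> (2 * int (nat M) + 1)"
  proof -
    have "tournament_det H \<le> (2 * int (nat M) + 1)\<^sup>2" if "H \<in> ?S" for H
    proof -
      have "tournament_det H \<le> \<bar>tournament_det H\<bar>" by simp
      also have "\<dots> \<le> M"
        unfolding M_def using that fin by (intro member_le_sum) auto
      also have "\<dots> \<le> (2 * M + 1)\<^sup>2"
        using M0 by (simp add: power2_eq_square algebra_simps)
      finally show ?thesis using M0 by simp
    qed
    then show ?thesis using assms by (auto simp: det_class_def)
  qed
  define m where "m = (LEAST m. T \<in> \<D> (2 * int m + 1))"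
  have m: "T \<in> \<D> (2 * int m + 1)"
    unfolding m_def by (rule LeastI, rule big)
  have least: "T \<notin> \<D> (2 * int m' + 1)" if "m' < m" for m'
    using that not_less_Least unfolding m_def by blast
  show ?thesis
  proof (rule ex1I[of _ "2 * int m + 1"])
    have "T \<notin> \<D> (2 * int m + 1 - 2)"
    proof (cases m)
      case 0
      then show ?thesis by (simp add: det_class_def)
    next
      case (Suc m')
      then show ?thesis using least[of m'] by (simp add: add.commute)
    qed
    then show "2 * int m + 1 \<ge> 1 \<and> odd (2 * int m + 1) \<and>
        T \<in> \<D> (2 * int m + 1) - \<D> (2 * int m + 1 - 2)"
      using m by simp
  next
    fix k :: int
    assume k: "k \<ge> 1 \<and> odd k \<and> T \<in> \<D> k - \<D> (k - 2)"
    then obtain l where l: "k = 2 * l + 1" by (auto elim: oddE)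
    with k have l0: "l \<ge> 0" by simp
    have "\<not> int m < l"
    proof
      assume "int m < l"
      then have "T \<in> \<D> (k - 2)"
        using m l det_class_mono[of "2 * int m + 1" "k - 2"] by auto
      with k show False by simp
    qed
    moreover have "\<not> l < int m"
      using least[of "nat l"] k l l0 by (auto simp: nat_less_iff)
    ultimately show "k = 2 * int m + 1" using l by simp
  qed
qed

lemma tournament_switch:
  assumes "tournament T"
  shows "tournament (switch T W)"
proof -
  interpret tournament T by fact
  have sub: "parcs (switch T W) \<subseteq> pverts T \<times> pverts T"
    using in_arcsD1 in_arcsD2 by (auto simp: switch_def)
  have V: "pverts (switch T W) = pverts T"
    by (simp add: switch_def)
  show ?thesis
  proof
    show "fst e \<in> pverts (switch T W)" "snd e \<in> pverts (switch T W)"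
      if "e \<in> parcs (switch T W)" for e
      using that sub V by auto
    show "finite (pverts (switch T W))" "finite (parcs (switch T W))"
      using pair_finite_verts finite_subset[OF sub] V by auto
    show "fst e \<noteq> snd e" if "e \<in> parcs (switch T W)" for e
      using that pair_no_loops[of e] by (auto simp: switch_def)
    show "(u, v) \<in> parcs (switch T W) \<longleftrightarrow> (v, u) \<notin> parcs (switch T W)"
      if "u \<in> pverts (switch T W)" "v \<in> pverts (switch T W)" "u \<noteq> v" for u v
      using exactly_one_arc[of u v] that V by (simp add: switch_def) blast
  qed
qed

lemma tournament_vertex_extension:
  assumes "tournament T" "u \<notin> pverts T"
  shows "tournament (vertex_extension T u \<sigma>)" (is "tournament ?U")
proof -
  interpret tournament T by fact
  have sub: "parcs ?U \<subseteq> insert u (pverts T) \<times> insert u (pverts T)"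
    using in_arcsD1 in_arcsD2 by (auto simp: vertex_extension_def)
  have V: "pverts ?U = insert u (pverts T)"
    by (simp add: vertex_extension_def)
  have fresh: "(u, x) \<notin> parcs T" "(x, u) \<notin> parcs T" for x
    using assms(2) in_arcsD1 in_arcsD2 by blast+
  show ?thesis
  proof
    show "fst e \<in> pverts ?U" "snd e \<in> pverts ?U" if "e \<in> parcs ?U" for e
      using that sub V by auto
    show "finite (pverts ?U)" "finite (parcs ?U)"
      using pair_finite_verts finite_subset[OF sub] V by auto
    show "fst e \<noteq> snd e" if "e \<in> parcs ?U" for e
      using that pair_no_loops[of e] assms(2) by (auto simp: vertex_extension_def)
    show "(x, y) \<in> parcs ?U \<longleftrightarrow> (y, x) \<notin> parcs ?U"
      if "x \<in> pverts ?U" "y \<in> pverts ?U" "x \<noteq> y" for x y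
    proof (cases "x = u \<or> y = u")
      case True
      then show ?thesis
        using that V fresh assms(2) by (auto simp: vertex_extension_def)
    next
      case False
      then show ?thesis
        using exactly_one_arc[of x y] that V by (simp add: vertex_extension_def)
    qed
  qed
qed

end

theory Submission
  imports Defs
begin

text \<open>Switching with respect to \<open>W\<close> conjugates the skew-adjacency matrix by the diagonal
  matrix with entries \<open>-1\<close> on \<open>W\<close> and \<open>1\<close> elsewhere, so it preserves the determinants of all
  induced subtournaments and hence every class \<open>\<D> k\<close>. It also preserves CR association, because
  \<open>\<theta>(u\<^sub>1, v)\<close> and \<open>\<theta>(u\<^sub>2, v)\<close> change by factors whose ratio does not depend on \<open>v\<close>, and it
  preserves diamonds. Finally, the switch of a one-vertex extension is a one-vertex extension of
  the switch, with the signs on \<open>W\<close> negated; as switching is an involution, the defining condition of a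
  CR tournament is transferred in both directions.\<close>

definition switch_sign :: "'a set \<Rightarrow> 'a \<Rightarrow> int" where
  "switch_sign W v = (if v \<in> W then -1 else 1)"

lemma pverts_switch [simp]: "pverts (switch T W) = pverts T"
  by (simp add: switch_def)

lemma in_parcs_switch:
  "(u, v) \<in> parcs (switch T W) \<longleftrightarrow>
     (if u \<in> W \<longleftrightarrow> v \<in> W then (u, v) \<in> parcs T else (v, u) \<in> parcs T)"
  by (auto simp: switch_def)

text \<open>Supplies the converse directions: where switching is shown to preserve a property,
  switching back by the same set makes this an equivalence.\<close>

lemma switch_switch: "switch (switch T W) W = T"
proof (rule pair_pre_digraph.equality)
  show "parcs (switch (switch T W) W) = parcs T"
    by (auto simp: in_parcs_switch split: if_splits)
qed simp_all

lemma (in tournament) arc_asym: "(u, v) \<in> parcs T \<Longrightarrow> (v, u) \<notin> parcs T"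
  using exactly_one_arc[of u v] in_arcsD1 in_arcsD2 pair_no_loops[of "(u, v)"] by fastforce

text \<open>The matrix is \<open>D * A * D\<close> with \<open>D\<close> diagonal and
  \<open>D * D\<close> the identity, so \<open>det D\<close> enters only through its square, which
  is 1.\<close>

lemma det_diag_conjugate:
  fixes A :: "int mat"
  assumes A: "A \<in> carrier_mat n n" and s: "\<And>i. i < n \<Longrightarrow> s i * s i = 1"
  shows "det (mat n n (\<lambda>(i, j). s i * A $$ (i, j) * s j)) = det A"
proof -
  define D where "D = mat_diag n s"
  have D: "D \<in> carrier_mat n n" by (simp add: D_def)
  have "D * D = 1\<^sub>m n"
    unfolding D_def mat_diag_mult_left[OF mat_diag_dim]
    by (rule eq_matI) (auto simp: mat_diag_def s)
  then have sq: "det D * det D = 1"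
    using det_mult[OF D D] by simp
  have "mat n n (\<lambda>(i, j). s i * A $$ (i, j) * s j) = D * A * D"
    unfolding D_def mat_diag_mult_left[OF A]
    by (subst mat_diag_mult_right[of _ n]) (auto intro!: eq_matI)
  then have "det (mat n n (\<lambda>(i, j). s i * A $$ (i, j) * s j)) = det D * det A * det D"
    using det_mult[of "D * A" n D] det_mult[OF D A] A D by simp
  also have "\<dots> = det D * det D * det A" by simp
  finally show ?thesis using sq by simp
qed

text \<open>Stated for finite asymmetric digraphs because an induced subgraph inherits exactly these
  properties directly. Asymmetry makes swapping the two arc directions negate an entry of
  \<open>skew_adjacency\<close>, which tests the forward arc first.\<close>

lemma tournament_det_switch:
  assumes fin: "finite (pverts H)"
    and asym: "\<And>u v. (u, v) \<in> parcs H \<Longrightarrow> (v, u) \<notin> parcs H"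
  shows "tournament_det (switch H W) = tournament_det H"
proof -
  obtain vs where vs: "distinct vs" "set vs = pverts H"
    using finite_distinct_list[OF fin] by blast
  have "skew_adjacency (switch H W) vs =
      mat (length vs) (length vs) (\<lambda>(i, j). switch_sign W (vs ! i) *
        skew_adjacency H vs $$ (i, j) * switch_sign W (vs ! j))"
    by (rule eq_matI)
      (auto simp: skew_adjacency_def in_parcs_switch switch_sign_def dest: asym)
  also have "det \<dots> = det (skew_adjacency H vs)"
    by (rule det_diag_conjugate) (auto simp: skew_adjacency_def switch_sign_def)
  finally show ?thesis
    using vs tournament_det_eq[of vs H] tournament_det_eq[of vs "switch H W"] by simp
qed

text \<open>Whether an arc is reversed depends only on its own endpoints, so restriction to a vertex
  set commutes with switching.\<close>

lemma induced_subgraph_switch: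
  assumes "induced_subgraph (with_proj H) (with_proj T)" "tournament T"
  shows "induced_subgraph (with_proj (switch H W)) (with_proj (switch T W))"
proof -
  interpret S: tournament "switch T W" by (rule tournament_switch) fact
  have sub: "pverts H \<subseteq> pverts T"
    and arcs: "parcs H = {e \<in> parcs T. fst e \<in> pverts H \<and> snd e \<in> pverts H}"
    using assms(1) by (auto simp: induced_subgraph_def subgraph_def)
  have arcs': "parcs (switch H W) =
      {e \<in> parcs (switch T W). fst e \<in> pverts H \<and> snd e \<in> pverts H}"
    by (auto simp: in_parcs_switch arcs split: if_splits)
  have "wf_digraph (with_proj (switch H W))"
    by unfold_locales (auto simp: arcs')
  moreover have "wf_digraph (with_proj (switch T W))"
    by unfold_locales
  ultimately show ?thesis
    using sub arcs' by (auto simp: induced_subgraph_def subgraph_def compatible_def)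
qed

lemma switch_in_det_class:
  assumes "T \<in> \<D> k"
  shows "switch T W \<in> \<D> k"
proof -
  have k: "k \<noteq> -1" and T: "tournament T"
    and bound: "\<And>H. induced_subgraph (with_proj H) (with_proj T) \<Longrightarrow> tournament_det H \<le> k\<^sup>2"
    using assms by (auto simp: det_class_def split: if_splits)
  interpret S: tournament "switch T W" by (rule tournament_switch) fact
  have "tournament_det H \<le> k\<^sup>2"
    if H: "induced_subgraph (with_proj H) (with_proj (switch T W))" for H
  proof -
    have "pverts H \<subseteq> pverts T" "parcs H \<subseteq> parcs (switch T W)"
      using H by (auto simp: induced_subgraph_def subgraph_def)
    then have "finite (pverts H)" "\<And>u v. (u, v) \<in> parcs H \<Longrightarrow> (v, u) \<notin> parcs H"
      using S.arc_asym S.pair_finite_verts finite_subset[of "pverts H" "pverts T"]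
      by (simp, blast)
    then have "tournament_det (switch H W) = tournament_det H"
      by (rule tournament_det_switch)
    \<comment> \<open>Switching \<open>H\<close> back lands inside \<open>T\<close> itself, where
      the assumed bound applies.\<close>
    moreover have "induced_subgraph (with_proj (switch H W)) (with_proj T)"
      using induced_subgraph_switch[OF H S.tournament_axioms, of W] by (simp add: switch_switch)
    ultimately show ?thesis
      using bound[of "switch H W"] by simp
  qed
  with k S.tournament_axioms show ?thesis by (simp add: det_class_def)
qed

lemma switch_in_det_class_iff: "switch T W \<in> \<D> k \<longleftrightarrow> T \<in> \<D> k"
  using switch_in_det_class switch_switch by metis

lemma theta_switch:
  assumes "tournament T" "u \<in> pverts T" "v \<in> pverts T" "u \<noteq> v"
  shows "theta (switch T W) u v = switch_sign W u * switch_sign W v * theta T u v"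
  using tournament.exactly_one_arc[OF assms]
  by (auto simp: theta_def in_parcs_switch switch_sign_def)

text \<open>With at least three vertices, covertices and revertices trade places when
  \<open>W\<close> contains exactly one of \<open>x\<close> and \<open>y\<close>; only their
  disjunction is invariant.\<close>

lemma CR_associated_switch:
  assumes T: "tournament T" and "CR_associated T x y"
  shows "CR_associated (switch T W) x y"
proof -
  let ?n = "card (pverts T)"
  have xy: "x \<in> pverts T" "y \<in> pverts T" "x \<noteq> y"
    and cases: "?n = 2 \<or> ?n \<ge> 3 \<and>
      ((\<forall>v \<in> pverts T - {x, y}. theta T x v = theta T y v) \<or>
       (\<forall>v \<in> pverts T - {x, y}. theta T x v = - theta T y v))"
    using assms(2) by (auto simp: CR_associated_def covertices_def revertices_def)
  have th: "theta (switch T W) z v = switch_sign W z * switch_sign W v * theta T z v"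
    if "v \<in> pverts T - {x, y}" "z \<in> {x, y}" for z v
    using that xy by (intro theta_switch[OF T]) auto
  \<comment> \<open>The sign \<open>e\<close> treats both relations at once: 1 for covertices, -1
    for revertices.\<close>
  have "(\<forall>v \<in> pverts T - {x, y}. theta (switch T W) x v = theta (switch T W) y v) \<or>
      (\<forall>v \<in> pverts T - {x, y}. theta (switch T W) x v = - theta (switch T W) y v)"
    if "\<forall>v \<in> pverts T - {x, y}. theta T x v = e * theta T y v" "e \<in> {1, -1}" for e
  proof -
    \<comment> \<open>The new ratio: \<open>switch_sign W v\<close> occurs in both values of
      \<open>theta\<close> and cancels.\<close>
    let ?f = "switch_sign W x * switch_sign W y * e"
    have "theta (switch T W) x v = ?f * theta (switch T W) y v"
      if v: "v \<in> pverts T - {x, y}" for v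
    proof -
      have "theta T x v = e * theta T y v"
        using \<open>\<forall>v \<in> _. theta T x v = _\<close> v by blast
      then show ?thesis
        using th[OF v, of x] th[OF v, of y] by (simp add: switch_sign_def)
    qed
    moreover have "?f = 1 \<or> ?f = -1"
      using that(2) by (auto simp: switch_sign_def)
    ultimately show ?thesis by (metis mult_1 mult_minus1)
  qed
  from this[of 1] this[of "-1"] cases
  have "?n = 2 \<or> ?n \<ge> 3 \<and>
      ((\<forall>v \<in> pverts T - {x, y}. theta (switch T W) x v = theta (switch T W) y v) \<or>
       (\<forall>v \<in> pverts T - {x, y}. theta (switch T W) x v = - theta (switch T W) y v))"
    by (metis insertCI mult_1 mult_minus1)
  then show ?thesis
    using xy unfolding CR_associated_def covertices_def revertices_def pverts_switch by blast
qed

text \<open>A finite check over the 16 ways \<open>W\<close> can meet the four vertices. The eight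
  disjuncts of \<open>dia\<close> are the two orientations of the 3-cycle for each choice of outer
  vertex.\<close>

lemma diamond_switch:
  assumes "diamond T"
  shows "diamond (switch T W)"
proof -
  obtain a b c d where D: "tournament T" "distinct [a, b, c, d]" "pverts T = {a, b, c, d}"
    and cyc: "(a, b) \<in> parcs T" "(b, c) \<in> parcs T" "(c, a) \<in> parcs T"
    and dom: "{(d, a), (d, b), (d, c)} \<subseteq> parcs T \<or> {(a, d), (b, d), (c, d)} \<subseteq> parcs T"
    using assms unfolding diamond_def by (elim conjE exE) (rule that, simp_all)
  interpret T: tournament T by fact
  let ?R = "\<lambda>x y. (x, y) \<in> parcs (switch T W)"
  let ?dia = "\<lambda>x y z w. ?R x y \<and> ?R y z \<and> ?R z x \<and>
    (?R w x \<and> ?R w y \<and> ?R w z \<or> ?R x w \<and> ?R y w \<and> ?R z w)"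
  have ncyc: "(b, a) \<notin> parcs T" "(c, b) \<notin> parcs T" "(a, c) \<notin> parcs T"
    using cyc T.arc_asym by blast+
  \<comment> \<open>The vertex outside the 3-cycle of the switched diamond can be any of the four.\<close>
  from dom consider
      "(d, a) \<in> parcs T" "(d, b) \<in> parcs T" "(d, c) \<in> parcs T"
    | "(a, d) \<in> parcs T" "(b, d) \<in> parcs T" "(c, d) \<in> parcs T"
    by blast
  then have dia: "?dia a b c d \<or> ?dia a c b d \<or> ?dia b c d a \<or> ?dia b d c a \<or>
      ?dia a c d b \<or> ?dia a d c b \<or> ?dia a b d c \<or> ?dia a d b c"
  proof cases
    case 1
    then have "(a, d) \<notin> parcs T" "(b, d) \<notin> parcs T" "(c, d) \<notin> parcs T"
      using T.arc_asym by blast+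
    with 1 cyc ncyc show ?thesis
      by (cases "a \<in> W"; cases "b \<in> W"; cases "c \<in> W"; cases "d \<in> W")
        (simp_all add: in_parcs_switch)
  next
    case 2
    then have "(d, a) \<notin> parcs T" "(d, b) \<notin> parcs T" "(d, c) \<notin> parcs T"
      using T.arc_asym by blast+
    with 2 cyc ncyc show ?thesis
      by (cases "a \<in> W"; cases "b \<in> W"; cases "c \<in> W"; cases "d \<in> W")
        (simp_all add: in_parcs_switch)
  qed
  have diaI: "diamond (switch T W)"
    if "?dia x y z w" "distinct [x, y, z, w]" "{x, y, z, w} = {a, b, c, d}" for x y z w
    unfolding diamond_def pverts_switch D(3) that(3)[symmetric]
    using tournament_switch[OF D(1)] that(1,2)
    by (intro conjI exI[of _ x] exI[of _ y] exI[of _ z] exI[of _ w]) simp_all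
  show ?thesis
    by (insert dia, elim disjE; (rule diaI, assumption, use D(2) in force, blast))
qed

lemma in_parcs_vertex_extension:
  "(x, y) \<in> parcs (vertex_extension T u \<sigma>) \<longleftrightarrow> (x, y) \<in> parcs T \<or>
     x = u \<and> y \<in> pverts T \<and> \<sigma> y = 1 \<or> y = u \<and> x \<in> pverts T \<and> \<sigma> x \<noteq> 1"
  by (auto simp: vertex_extension_def)

lemma switch_vertex_extension:
  assumes T: "tournament T" and u: "u \<notin> pverts T" "u \<notin> W" and \<sigma>: "\<sigma> \<in> pverts T \<rightarrow> {-1, 1}"
  shows "switch (vertex_extension T u \<sigma>) W =
    vertex_extension (switch T W) u (\<lambda>w. switch_sign W w * \<sigma> w)"
proof (rule pair_pre_digraph.equality)
  interpret tournament T by fact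
  have fresh: "(u, x) \<notin> parcs T" "(x, u) \<notin> parcs T" for x
    using u(1) in_arcsD1 in_arcsD2 by blast+
  \<comment> \<open>The extension only tests whether a sign equals 1, so negation reverses the arc
    because the values are restricted to 1 and -1.\<close>
  have flip: "switch_sign W w * \<sigma> w = 1 \<longleftrightarrow> (if w \<in> W then \<sigma> w \<noteq> 1 else \<sigma> w = 1)"
    if "w \<in> pverts T" for w
    using \<sigma> that by (auto simp: switch_sign_def)
  have "(x, y) \<in> parcs (switch (vertex_extension T u \<sigma>) W) \<longleftrightarrow>
      (x, y) \<in> parcs (vertex_extension (switch T W) u (\<lambda>w. switch_sign W w * \<sigma> w))" for x y
    using u fresh flip[of x] flip[of y]
    by (cases "x = u"; cases "y = u") (auto simp: in_parcs_switch in_parcs_vertex_extension)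
  then show "parcs (switch (vertex_extension T u \<sigma>) W) =
      parcs (vertex_extension (switch T W) u (\<lambda>w. switch_sign W w * \<sigma> w))"
    by auto
qed (simp_all add: vertex_extension_def)

lemma CR_tournament_switch:
  assumes "CR_tournament T" "W \<subseteq> pverts T"
  shows "CR_tournament (switch T W)"
proof -
  obtain k where k: "k \<ge> 1" "odd k" "T \<in> \<D> k - \<D> (k - 2)"
    and CR: "card (pverts T) = 1 \<or> card (pverts T) = 2 \<or> diamond T \<or>
      (\<forall>u \<sigma>. u \<notin> pverts T \<longrightarrow> \<sigma> \<in> pverts T \<rightarrow> {-1, 1} \<longrightarrow> \<not> CR_vertex T u \<sigma> \<longrightarrow>
         vertex_extension T u \<sigma> \<notin> \<D> k)"
    using assms(1) unfolding CR_tournament_def by blast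
  have T: "tournament T"
    using k by (auto simp: det_class_def split: if_splits)
  have "vertex_extension (switch T W) u \<sigma> \<notin> \<D> k"
    if gen: "\<forall>u \<sigma>. u \<notin> pverts T \<longrightarrow> \<sigma> \<in> pverts T \<rightarrow> {-1, 1} \<longrightarrow> \<not> CR_vertex T u \<sigma> \<longrightarrow>
         vertex_extension T u \<sigma> \<notin> \<D> k"
      and u: "u \<notin> pverts T" and \<sigma>: "\<sigma> \<in> pverts T \<rightarrow> {-1, 1}"
      and nCR: "\<not> CR_vertex (switch T W) u \<sigma>" for u \<sigma>
  proof -
    \<comment> \<open>Pulls the signs back to \<open>T\<close>; applying \<open>switch_sign\<close>
      twice recovers \<sigma>.\<close>
    define \<tau> where "\<tau> = (\<lambda>w. switch_sign W w * \<sigma> w)"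
    have \<tau>: "\<tau> \<in> pverts T \<rightarrow> {-1, 1}"
      using \<sigma> by (fastforce simp: \<tau>_def switch_sign_def)
    have "(\<lambda>w. switch_sign W w * \<tau> w) = \<sigma>"
      by (auto simp: \<tau>_def switch_sign_def)
    \<comment> \<open>Here \<open>u\<close> lies outside \<open>W\<close> because \<open>W\<close>
      consists of vertices of \<open>T\<close>.\<close>
    then have ext: "switch (vertex_extension T u \<tau>) W = vertex_extension (switch T W) u \<sigma>"
      using switch_vertex_extension[OF T u _ \<tau>, of W] u assms(2) by auto
    \<comment> \<open>Otherwise a CR association of \<open>u\<close> in the extension of
      \<open>T\<close> would survive the switch and contradict \<open>nCR\<close>.\<close>
    have "\<not> CR_vertex T u \<tau>"
      using nCR CR_associated_switch[OF tournament_vertex_extension[OF T u, of \<tau>], where W = W]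
      by (auto simp: CR_vertex_def ext)
    then show ?thesis
      using gen u \<tau> by (metis ext switch_in_det_class_iff)
  qed
  then show ?thesis
    \<comment> \<open>The same \<open>k\<close> serves as witness, since membership in both
      \<open>\<D> k\<close> and \<open>\<D> (k - 2)\<close> is unchanged by switching.\<close>
    using k CR diamond_switch[of T W]
    unfolding CR_tournament_def by (auto simp: switch_in_det_class_iff intro!: exI[of _ k])
qed

theorem theorem4p3:
  fixes T\<^sub>1 T\<^sub>2 :: "('a::infinite) pair_pre_digraph" and V :: "'a set"
  assumes "tournament T\<^sub>1" and "tournament T\<^sub>2"
    and "pverts T\<^sub>1 = V" and "pverts T\<^sub>2 = V"
    and "switching_equivalent T\<^sub>1 T\<^sub>2"
  shows "CR_tournament T\<^sub>1 \<longleftrightarrow> CR_tournament T\<^sub>2"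
proof -
  obtain W where W: "W \<subseteq> pverts T\<^sub>1" and T\<^sub>2: "T\<^sub>2 = switch T\<^sub>1 W"
    using assms(5) unfolding switching_equivalent_def by blast
  show ?thesis
    using CR_tournament_switch[of T\<^sub>1 W] CR_tournament_switch[of T\<^sub>2 W] W
    by (auto simp: T\<^sub>2 switch_switch)
qed

end
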